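(* Consider a fluid timed Petri net that has no priority rules, is non-Zeno, and admits a positive stoichiometric invariant $e$. Let $T=\max_{p\in\mathcal{P}}\tau_p$ (holding times may be arbitrary nonnegative reals). Then: (i) There exists an affine stationary regime, i.e. a pair $(\rho,u)\in(\mathbb{R}_{\ge0})^{\mathcal{Q}}\times\mathbb{R}^{\mathcal{Q}}$ such that, initializing the dynamics with $z(t)=\rho t+u$ for $t\in[-T,0]$, one has $z(t)=\rho t+u$ for all $t\ge0$. (ii) The vector $\rho$ in (i) is universal: for any initial condition (continuous function $[-T,0]\to\mathbb{R}^{\mathcal{Q}}$), the solution $z(t)$ of the dynamics satisfies $z(t)=\rho t+O(1)$ as $t\to\infty$.
   Context: A fluid timed Petri net without priority rules consists of: two finite disjoint sets $\mathcal{P}$ (places) and $\mathcal{Q}$ (transitions); a directed bipartite graph on $\mathcal{P}\cup\mathcal{Q}$, where $x^{\mathrm{in}}$ (resp. $x^{\mathrm{out}}$) denotes the set of vertices $y$ with an arc from $y$ to $x$ (resp. from $x$ to $y$), and every transition has at least one upstream place; an initial marking $m_p\ge 0$ and a holding time $\tau_p\ge 0$ for each place $p$; a weight $\alpha_{qp}>0$ for each arc from place $p$ to transition $q$, and a weight $\alpha_{pq}>0$ for each arc from transition $q$ to place $p$. Each place $p$ is of one of two kinds. Either $p$ is ruled by (proportional) preselection: a probability vector $(\pi_{qp})_{q\in p^{\mathrm{out}}}$ is given, and every $q\in p^{\mathrm{out}}$ has $p$ as its only upstream place. Or $p$ has at most one downstream transition $q$, and then one sets $\pi_{qp}=1$.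 Dynamics: a trajectory is a function $z=(z_q)_{q\in\mathcal{Q}}:[-T,\infty)\to\mathbb{R}^{\mathcal{Q}}$ such that for all $t>0$ and $q\in\mathcal{Q}$, $$z_q(t)=\min_{p\in q^{\mathrm{in}}}\ \pi_{qp}\,\alpha_{qp}^{-1}\Big(m_p+\sum_{q'\in p^{\mathrm{in}}}\alpha_{pq'}\,z_{q'}(t-\tau_p)\Big).$$ Its initial condition is its restriction to $[-T,0]$; for a non-Zeno net the trajectory is uniquely determined by its initial condition. The net is non-Zeno if its directed graph contains no directed circuit all of whose places have zero holding time. A stoichiometric invariant is a vector $e\in\mathbb{R}^{\mathcal{Q}}$ such that for all $q\in\mathcal{Q}$ and all $p\in q^{\mathrm{in}}$, $e_q=\pi_{qp}\alpha_{qp}^{-1}\sum_{q'\in p^{\mathrm{in}}}\alpha_{pq'}e_{q'}$. It is positive if $e_q>0$ for all $q$. *)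

theory Defs
  imports "HOL-Analysis.Analysis" "HOL-Library.Landau_Symbols"
begin

text \<open>
  The finite disjoint sets of places and of transitions are the types 'p and 'q. The bipartite
  graph is given by its two sets of arcs. The weight of the arc from p to q is
  \<open>weight_pt N q p\<close> and that of the arc from q to p is \<open>weight_tp N p q\<close>: the index order is that
  of $\alpha_{qp}$, $\alpha_{pq}$ and $\pi_{qp}$. Weights and routing proportions are only
  meaningful on arcs.
\<close>

record ('p, 'q) fluid_net =
  arcs_pt :: "('p \<times> 'q) set"
  arcs_tp :: "('q \<times> 'p) set"
  marking :: "'p \<Rightarrow> real"
  holding :: "'p \<Rightarrow> real"
  weight_pt :: "'q \<Rightarrow> 'p \<Rightarrow> real"
  weight_tp :: "'p \<Rightarrow> 'q \<Rightarrow> real"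
  routing :: "'q \<Rightarrow> 'p \<Rightarrow> real"

definition trans_in :: "('p, 'q) fluid_net \<Rightarrow> 'q \<Rightarrow> 'p set" where
  "trans_in N q = {p. (p, q) \<in> arcs_pt N}"

definition place_out :: "('p, 'q) fluid_net \<Rightarrow> 'p \<Rightarrow> 'q set" where
  "place_out N p = {q. (p, q) \<in> arcs_pt N}"

definition place_in :: "('p, 'q) fluid_net \<Rightarrow> 'p \<Rightarrow> 'q set" where
  "place_in N p = {q. (q, p) \<in> arcs_tp N}"

definition preselection_place :: "('p, 'q::finite) fluid_net \<Rightarrow> 'p \<Rightarrow> bool" where
  "preselection_place N p \<longleftrightarrow>
     (\<forall>q\<in>place_out N p. routing N q p \<ge> 0) \<and> (\<Sum>q\<in>place_out N p. routing N q p) = 1 \<and>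
     (\<forall>q\<in>place_out N p. trans_in N q = {p})"

definition single_output_place :: "('p, 'q::finite) fluid_net \<Rightarrow> 'p \<Rightarrow> bool" where
  "single_output_place N p \<longleftrightarrow>
     card (place_out N p) \<le> 1 \<and> (\<forall>q\<in>place_out N p. routing N q p = 1)"

definition fluid_petri_net :: "('p::finite, 'q::finite) fluid_net \<Rightarrow> bool" where
  "fluid_petri_net N \<longleftrightarrow>
     (\<forall>q. trans_in N q \<noteq> {}) \<and>
     (\<forall>p. marking N p \<ge> 0) \<and>
     (\<forall>p. holding N p \<ge> 0) \<and>
     (\<forall>(p, q)\<in>arcs_pt N. weight_pt N q p > 0) \<and>
     (\<forall>(q, p)\<in>arcs_tp N. weight_tp N p q > 0) \<and>
     (\<forall>p. preselection_place N p \<or> single_output_place N p)"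

definition arcs :: "('p, 'q) fluid_net \<Rightarrow> ('p + 'q) rel" where
  "arcs N = {(Inl p, Inr q) | p q. (p, q) \<in> arcs_pt N} \<union>
            {(Inr q, Inl p) | q p. (q, p) \<in> arcs_tp N}"

text \<open>A circuit is a closed directed path; it need not be elementary.\<close>

definition directed_circuit :: "('p, 'q) fluid_net \<Rightarrow> ('p + 'q) list \<Rightarrow> bool" where
  "directed_circuit N vs \<longleftrightarrow>
     vs \<noteq> [] \<and> (\<forall>i<length vs. (vs ! i, vs ! (Suc i mod length vs)) \<in> arcs N)"

definition non_zeno :: "('p, 'q) fluid_net \<Rightarrow> bool" where
  "non_zeno N \<longleftrightarrow>
     \<not> (\<exists>vs. directed_circuit N vs \<and> (\<forall>p. Inl p \<in> set vs \<longrightarrow> holding N p = 0))"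

definition stoichiometric_invariant ::
    "('p::finite, 'q::finite) fluid_net \<Rightarrow> real ^ 'q \<Rightarrow> bool" where
  "stoichiometric_invariant N e \<longleftrightarrow>
     (\<forall>q. \<forall>p\<in>trans_in N q.
        e $ q = routing N q p / weight_pt N q p * (\<Sum>q'\<in>place_in N p. weight_tp N p q' * e $ q'))"

definition max_holding :: "('p::finite, 'q) fluid_net \<Rightarrow> real" where
  "max_holding N = Max (range (holding N))"

text \<open>
  Trajectories live on [-T, \<open>\<infinity>\<close>) with T = \<open>max_holding N\<close>. They are represented by total
  functions, whose values before -T do not enter the equations.
\<close>

definition trajectory ::
    "('p::finite, 'q::finite) fluid_net \<Rightarrow> (real \<Rightarrow> real ^ 'q) \<Rightarrow> bool" where
  "trajectory N z \<longleftrightarrow>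
     (\<forall>t>0. \<forall>q. z t $ q =
        Min ((\<lambda>p. routing N q p / weight_pt N q p *
                (marking N p + (\<Sum>q'\<in>place_in N p. weight_tp N p q' * z (t - holding N p) $ q')))
             ` trans_in N q))"

definition trajectory_from ::
    "('p::finite, 'q::finite) fluid_net \<Rightarrow> (real \<Rightarrow> real ^ 'q) \<Rightarrow> (real \<Rightarrow> real ^ 'q) \<Rightarrow> bool" where
  "trajectory_from N z0 z \<longleftrightarrow> trajectory N z \<and> (\<forall>t\<in>{- max_holding N..0}. z t = z0 t)"

definition affine_stationary_regime ::
    "('p::finite, 'q::finite) fluid_net \<Rightarrow> real ^ 'q \<Rightarrow> real ^ 'q \<Rightarrow> bool" where
  "affine_stationary_regime N \<rho> u \<longleftrightarrow>
     (\<forall>q. \<rho> $ q \<ge> 0) \<and>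
     (\<exists>z. trajectory_from N (\<lambda>t. t *\<^sub>R \<rho> + u) z) \<and>
     (\<forall>z. trajectory_from N (\<lambda>t. t *\<^sub>R \<rho> + u) z \<longrightarrow> (\<forall>t\<ge>0. z t = t *\<^sub>R \<rho> + u))"

end

theory Submission imports Defs begin

text \<open>
  Dividing by the positive invariant \<open>e\<close> turns the dynamics into
  \<open>x\<^sub>q(t) = min\<^sub>p (c\<^sub>q\<^sub>p + \<Sum>\<^sub>r k\<^sub>q\<^sub>p\<^sub>r x\<^sub>r(t - \<tau>\<^sub>p))\<close> with costs \<open>c \<ge> 0\<close> and weights \<open>k\<close> that are
  probabilities: invariance of \<open>e\<close> says exactly that they sum to one. This is the equation for the
  minimal cost over a horizon \<open>t\<close> of a semi-Markov decision process whose states are the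
  transitions and whose actions are the upstream places.

  The net is non-Zeno, so the dependencies of zero delay are acyclic and there is a potential
  \<open>h\<close> for which all the reduced delays \<open>\<tau>\<^sub>p + h\<^sub>q - h\<^sub>r\<close> are positive (\<open>positive_reduced_delays\<close>).
  Consequently the recursion for the trajectory is well-founded, and shifting the clock of \<open>q\<close> by
  \<open>h\<^sub>q\<close> gives an equivalent process with positive delays only.

  An affine regime of that process is an invariant half-line. Its slope \<open>\<rho>\<close> and intercept \<open>u\<close> come
  from vanishing discount. Replacing a delay \<open>d\<close> by the factor \<open>1 - s d\<close> gives an equation with a
  solution \<open>v\<^sub>s\<close> for each small \<open>s > 0\<close>. One policy is optimal for a sequence of discounts tending to
  0, and for a fixed policy \<open>v\<^sub>s = \<rho> / s + O(1)\<close> (\<open>policy_evaluation\<close>,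
  \<open>discounted_value_expansion\<close>). Along a subsequence the bounded part converges to some \<open>u\<close>, and
  the two leading orders of the optimality of \<open>v\<^sub>s\<close> say that \<open>(\<rho>, u)\<close> is optimal in the lexicographic
  order (\<open>lexicographically_optimal_pair\<close>), that is, that \<open>\<rho> t + u\<close> solves the undiscounted
  equation for all large \<open>t\<close>. A translation of time moves the start of this half-line to 0.

  Universality of \<open>\<rho>\<close> is a comparison principle. The dynamics is monotone and commutes with the
  addition of multiples of \<open>e\<close>, so two trajectories within \<open>K e\<close> of each other on the initial
  interval stay so for ever (\<open>trajectory_comparison\<close>), and every continuous initial condition is
  within such a distance of an affine one.
\<close>

section \<open>Minima and weighted means over finite sets\<close>

lemma eq_Min_image_iff:
  fixes f :: "'p \<Rightarrow> 'b::linorder"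
  assumes "finite A" "A \<noteq> {}"
  shows "m = Min (f ` A) \<longleftrightarrow> (\<forall>p\<in>A. m \<le> f p) \<and> (\<exists>p\<in>A. m = f p)"
proof
  assume m: "m = Min (f ` A)"
  moreover have "Min (f ` A) \<in> f ` A" using assms by (intro Min_in) auto
  ultimately have "m \<in> f ` A" by (simp only:)
  moreover have "\<forall>p\<in>A. m \<le> f p" using m assms by simp
  ultimately show "(\<forall>p\<in>A. m \<le> f p) \<and> (\<exists>p\<in>A. m = f p)" by blast
next
  assume "(\<forall>p\<in>A. m \<le> f p) \<and> (\<exists>p\<in>A. m = f p)"
  then show "m = Min (f ` A)"
    using assms by (intro Min_eqI[symmetric]) auto
qed

lemma continuous_on_Min_image:
  fixes f :: "'p \<Rightarrow> 'a::topological_space \<Rightarrow> real"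
  assumes "finite A" "A \<noteq> {}" "\<And>p. p \<in> A \<Longrightarrow> continuous_on S (f p)"
  shows "continuous_on S (\<lambda>x. Min ((\<lambda>p. f p x) ` A))"
  using assms
proof (induction A rule: finite_ne_induct)
  case (insert p A)
  then show ?case by (auto intro!: continuous_on_min)
qed auto

lemma weighted_mean_le:
  fixes w f :: "'a \<Rightarrow> real"
  assumes "\<And>i. i \<in> I \<Longrightarrow> w i \<ge> 0" "sum w I = 1" "\<And>i. i \<in> I \<Longrightarrow> f i \<le> M"
  shows "(\<Sum>i\<in>I. w i * f i) \<le> M"
proof -
  have "(\<Sum>i\<in>I. w i * f i) \<le> (\<Sum>i\<in>I. w i * M)"
    by (intro sum_mono mult_left_mono assms)
  also have "\<dots> = M" using assms(2) by (simp flip: sum_distrib_right)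
  finally show ?thesis .
qed

section \<open>Markov chains with positive delays\<close>

locale semi_markov_chain =
  fixes k d :: "'q::finite \<Rightarrow> 'q \<Rightarrow> real"
  assumes k_nonneg: "k q r \<ge> 0"
    and k_sum: "(\<Sum>r\<in>UNIV. k q r) = 1"
    and d_pos: "d q r > 0"
begin

lemma delay_bounds:
  obtains \<delta> D where "\<delta> > 0" "\<And>q r. \<delta> \<le> d q r" "\<And>q r. d q r \<le> D"
proof
  let ?S = "range (\<lambda>(q, r). d q r)"
  show "Min ?S > 0" using d_pos by (subst Min_gr_iff) auto
  show "Min ?S \<le> d q r" for q r by (rule Min_le) auto
  show "d q r \<le> Max ?S" for q r by (rule Max_ge) auto
qed

text \<open>
  On the set where a harmonic \<open>\<rho>\<close> is maximal the chain is trapped. If that maximum were positive,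
  every step there would raise the bias \<open>u\<close> by a positive amount on average, which is
  impossible at a state of the set where \<open>u\<close> is largest.
\<close>

lemma no_positive_drift:
  assumes \<rho>: "\<And>q. \<rho> q = (\<Sum>r\<in>UNIV. k q r * \<rho> r)"
    and u: "\<And>q. u q = (\<Sum>r\<in>UNIV. k q r * (u r - d q r * \<rho> r))"
  shows "\<rho> q \<le> 0"
proof (rule ccontr)
  define M where "M = Max (range \<rho>)"
  define S where "S = {q. \<rho> q = M}"
  assume "\<not> \<rho> q \<le> 0"
  have M_ge: "\<rho> r \<le> M" for r unfolding M_def by (rule Max_ge) auto
  with \<open>\<not> \<rho> q \<le> 0\<close> have "M > 0" by (meson less_le_trans not_le)
  have "M \<in> range \<rho>" unfolding M_def by (rule Max_in) auto
  then have "S \<noteq> {}" by (auto simp: S_def)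
  then obtain a where a: "a \<in> S" "\<And>b. b \<in> S \<Longrightarrow> u b \<le> u a"
    using obtains_MAX[of S u] by (metis Max_ge finite finite_imageI imageI)
  have trapped: "r \<in> S" if "k a r \<noteq> 0" for r
  proof -
    have "(\<Sum>r\<in>UNIV. k a r * (M - \<rho> r)) = M * (\<Sum>r\<in>UNIV. k a r) - (\<Sum>r\<in>UNIV. k a r * \<rho> r)"
      by (simp add: algebra_simps sum_subtractf sum_distrib_left)
    also have "\<dots> = 0" using \<rho>[of a] a(1) by (simp add: k_sum S_def)
    finally have "\<forall>r. k a r * (M - \<rho> r) = 0"
      by (subst (asm) sum_nonneg_eq_0_iff) (auto intro!: mult_nonneg_nonneg k_nonneg M_ge)
    with that show ?thesis by (auto simp: S_def)
  qed
  have nonneg: "k a r * (u a - u r + d a r * \<rho> r) \<ge> 0" for r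
  proof (cases "k a r = 0")
    case False
    then show ?thesis using trapped[of r] a(2)[of r] d_pos[of a r] \<open>M > 0\<close>
      by (intro mult_nonneg_nonneg k_nonneg add_nonneg_nonneg) (auto simp: S_def)
  qed simp
  have "(\<Sum>r\<in>UNIV. k a r * (u a - u r + d a r * \<rho> r)) =
      u a * (\<Sum>r\<in>UNIV. k a r) - (\<Sum>r\<in>UNIV. k a r * (u r - d a r * \<rho> r))"
    by (simp add: algebra_simps sum_subtractf sum.distrib sum_distrib_left)
  also have "\<dots> = 0" using u[of a] by (simp add: k_sum)
  finally have zero: "k a r * (u a - u r + d a r * \<rho> r) = 0" for r
    by (subst (asm) sum_nonneg_eq_0_iff) (use nonneg in auto)
  obtain r where r: "k a r \<noteq> 0"
    using k_sum[of a] by (metis sum.neutral zero_neq_one)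
  have "d a r * \<rho> r > 0" using trapped[OF r] d_pos[of a r] \<open>M > 0\<close> by (auto simp: S_def)
  with zero[of r] r a(2)[OF trapped[OF r]] show False by auto
qed

text \<open>
  The unknowns are the growth rate \<open>\<rho>\<close>, which lies in the kernel of \<open>I - P\<close>, and the bias
  \<open>u\<close>. With \<open>proj\<close> a linear projection onto this kernel, the ansatz \<open>\<rho> = proj x\<close>, \<open>u = x\<close> turns the
  system into one square linear equation. It is injective because vanishing
  costs force the growth rate to be zero, hence it is surjective.
\<close>

lemma policy_evaluation:
  obtains \<rho> u :: "'q \<Rightarrow> real"
  where "\<And>q. \<rho> q = (\<Sum>r\<in>UNIV. k q r * \<rho> r)"
    and "\<And>q. u q = c q + (\<Sum>r\<in>UNIV. k q r * (u r - d q r * \<rho> r))"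
proof -
  define P :: "real^'q \<Rightarrow> real^'q" where "P x = (\<chi> q. \<Sum>r\<in>UNIV. k q r * x $ r)" for x
  define D :: "real^'q \<Rightarrow> real^'q" where "D x = (\<chi> q. \<Sum>r\<in>UNIV. k q r * (d q r * x $ r))" for x
  have linP: "linear P" and linD: "linear D"
    by (rule linearI;
        simp add: P_def D_def vec_eq_iff algebra_simps sum.distrib sum_distrib_left)+
  define K where "K = {x. P x = x}"
  have K: "subspace K"
    using linP by (auto simp: subspace_def K_def linear_0 linear_add linear_scale)
  obtain proj where proj: "range proj \<subseteq> K" "linear proj" "\<And>x. x \<in> K \<Longrightarrow> proj x = x"
    using real_vector.linear_exists_left_inverse_on[of id K] K linear_id by auto
  have harmonic: "y $ q = (\<Sum>r\<in>UNIV. k q r * y $ r)" if "y \<in> K" for y q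
  proof -
    have "y $ q = P y $ q" using that by (simp add: K_def)
    then show ?thesis by (simp add: P_def)
  qed
  define L where "L x = x - P x + D (proj x)" for x
  have linL: "linear L"
    unfolding L_def using linP linear_compose[OF proj(2) linD]
    by (intro linear_compose_add linear_compose_sub) (auto simp: o_def linear_ident)
  have "inj L"
  proof (subst linear_injective_0[OF linL], safe)
    fix x assume x: "L x = 0"
    define \<rho> where "\<rho> = proj x"
    have h: "\<rho> $ q = (\<Sum>r\<in>UNIV. k q r * \<rho> $ r)" for q
      unfolding \<rho>_def by (rule harmonic) (use proj(1) in auto)
    have "x = P x - D \<rho>" using x by (simp add: L_def \<rho>_def algebra_simps)
    then have "x $ q = (P x - D \<rho>) $ q" for q by simp
    then have u: "x $ q = (\<Sum>r\<in>UNIV. k q r * (x $ r - d q r * \<rho> $ r))" for q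
      by (simp add: P_def D_def algebra_simps sum_subtractf)
    have "\<rho> $ q \<le> 0" for q using no_positive_drift[of "($) \<rho>" "($) x"] h u by blast
    moreover have "- \<rho> $ q \<le> 0" for q
    proof (rule no_positive_drift[of "\<lambda>q. - \<rho> $ q" "\<lambda>q. - x $ q"])
      show "- \<rho> $ q = (\<Sum>r\<in>UNIV. k q r * - \<rho> $ r)" for q
        using h[of q] by (simp add: sum_negf)
      show "- x $ q = (\<Sum>r\<in>UNIV. k q r * (- x $ r - d q r * - \<rho> $ r))" for q
        using u[of q] by (simp add: algebra_simps sum_subtractf)
    qed
    ultimately have "\<rho> = 0" by (metis vec_eq_iff zero_index neg_le_0_iff_le order_antisym)
    then have "P x = x" using \<open>x = P x - D \<rho>\<close> linD by (simp add: linear_0)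
    then show "x = 0" using proj(3)[of x] \<open>\<rho> = 0\<close> by (simp add: K_def \<rho>_def)
  qed
  then have "surj L" using linL linear_injective_imp_surjective by blast
  then obtain x where x: "L x = (\<chi> q. c q)" by (metis surjD)
  show ?thesis
  proof
    show "proj x $ q = (\<Sum>r\<in>UNIV. k q r * proj x $ r)" for q
      by (rule harmonic) (use proj(1) in auto)
    show "x $ q = c q + (\<Sum>r\<in>UNIV. k q r * (x $ r - d q r * proj x $ r))" for q
    proof -
      have "c q = L x $ q" using x by simp
      then show ?thesis
        by (simp add: L_def P_def D_def algebra_simps sum_subtractf)
    qed
  qed
qed

text \<open>
  Inserting \<open>\<rho> / s + u\<close> into the discounted equation leaves a residual of order \<open>s\<close>, and the
  discounted operator contracts the sup norm by a factor \<open>1 - s \<delta>\<close>; the two powers of \<open>s\<close>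
  cancel, which makes the bound uniform in \<open>s\<close>.
\<close>

lemma discounted_value_expansion:
  assumes \<rho>: "\<And>q. \<rho> q = (\<Sum>r\<in>UNIV. k q r * \<rho> r)"
    and u: "\<And>q. u q = c q + (\<Sum>r\<in>UNIV. k q r * (u r - d q r * \<rho> r))"
  obtains B where "\<And>s v q. s > 0 \<Longrightarrow> (\<And>q r. s * d q r \<le> 1) \<Longrightarrow>
      (\<And>q. v q = c q + (\<Sum>r\<in>UNIV. k q r * ((1 - s * d q r) * v r))) \<Longrightarrow>
      \<bar>v q - (\<rho> q / s + u q)\<bar> \<le> B"
proof -
  obtain \<delta> D where \<delta>: "\<delta> > 0" "\<And>q r. \<delta> \<le> d q r" "\<And>q r. d q r \<le> D"
    using delay_bounds by blast
  define U where "U = Max (range (\<lambda>q. \<bar>u q\<bar>))"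
  have U: "\<bar>u q\<bar> \<le> U" for q unfolding U_def by (rule Max_ge) auto
  show ?thesis
  proof (rule that)
    fix s v q
    assume s: "s > 0" "\<And>q r. s * d q r \<le> 1"
      and v: "\<And>q. v q = c q + (\<Sum>r\<in>UNIV. k q r * ((1 - s * d q r) * v r))"
    define x where "x q = v q - (\<rho> q / s + u q)" for q
    have x: "x q = (\<Sum>r\<in>UNIV. k q r * ((1 - s * d q r) * x r - s * d q r * u r))" for q
    proof -
      have "(\<Sum>r\<in>UNIV. k q r * ((1 - s * d q r) * x r - s * d q r * u r)) =
        (\<Sum>r\<in>UNIV. k q r * ((1 - s * d q r) * v r)) - (\<Sum>r\<in>UNIV. k q r * \<rho> r) / s
          - (\<Sum>r\<in>UNIV. k q r * (u r - d q r * \<rho> r))"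
        unfolding sum_divide_distrib sum_subtractf[symmetric]
        using s(1) by (intro sum.cong refl) (simp add: x_def field_simps)
      also have "\<dots> = x q"
        using v[of q] \<rho>[of q] u[of q] by (simp add: x_def)
      finally show ?thesis by simp
    qed
    define M where "M = Max (range (\<lambda>q. \<bar>x q\<bar>))"
    have M: "\<bar>x q\<bar> \<le> M" for q unfolding M_def by (rule Max_ge) auto
    have "M \<in> range (\<lambda>q. \<bar>x q\<bar>)" unfolding M_def by (rule Max_in) auto
    then obtain a where a: "\<bar>x a\<bar> = M" by auto
    have "s * \<delta> \<le> s * d a a" using s(1) \<delta>(2) by simp
    then have s_\<delta>: "s * \<delta> \<le> 1" using s(2)[of a a] by linarith
    have "\<bar>x a\<bar> \<le> (\<Sum>r\<in>UNIV. \<bar>k a r * ((1 - s * d a r) * x r - s * d a r * u r)\<bar>)"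
      by (subst x[of a]) (rule sum_abs)
    also have "\<dots> = (\<Sum>r\<in>UNIV. k a r * \<bar>(1 - s * d a r) * x r - s * d a r * u r\<bar>)"
      by (simp add: abs_mult k_nonneg)
    also have "\<dots> \<le> (1 - s * \<delta>) * M + s * D * U"
    proof (rule weighted_mean_le)
      fix r
      have "\<bar>(1 - s * d a r) * x r - s * d a r * u r\<bar> \<le>
          \<bar>(1 - s * d a r) * x r\<bar> + \<bar>s * d a r * u r\<bar>" by (rule abs_triangle_ineq4)
      also have "\<dots> = (1 - s * d a r) * \<bar>x r\<bar> + s * d a r * \<bar>u r\<bar>"
        using s d_pos[of a r] by (simp add: abs_mult)
      also have "\<dots> \<le> (1 - s * \<delta>) * M + s * D * U"
        using s(1) s(2)[of a r] \<delta>(1) \<delta>(2,3)[of a r] M[of r] U[of r] s_\<delta>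
        by (intro add_mono mult_mono) auto
      finally show "\<bar>(1 - s * d a r) * x r - s * d a r * u r\<bar> \<le> (1 - s * \<delta>) * M + s * D * U" .
    qed (auto simp: k_nonneg k_sum)
    finally have "s * (M * \<delta>) \<le> s * (D * U)" using a by (simp add: algebra_simps)
    then have "M \<le> D * U / \<delta>" using s(1) \<delta>(1) by (simp add: field_simps)
    with M[of q] show "\<bar>v q - (\<rho> q / s + u q)\<bar> \<le> D * U / \<delta>" by (simp add: x_def)
  qed
qed

end

section \<open>Decision processes and their invariant half-lines\<close>

text \<open>
  In state \<open>q\<close> an action \<open>p \<in> A q\<close> costs \<open>c q p\<close> and leads to state \<open>r\<close> with probability \<open>k q p r\<close>,
  after the time \<open>d q p r\<close>.
\<close>

locale semi_markov_decision =
  fixes A :: "'q::finite \<Rightarrow> 'p::finite set"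
    and c :: "'q \<Rightarrow> 'p \<Rightarrow> real"
    and k d :: "'q \<Rightarrow> 'p \<Rightarrow> 'q \<Rightarrow> real"
  assumes A_nonempty: "A q \<noteq> {}"
    and c_nonneg: "p \<in> A q \<Longrightarrow> c q p \<ge> 0"
    and k_nonneg: "p \<in> A q \<Longrightarrow> k q p r \<ge> 0"
    and k_sum: "p \<in> A q \<Longrightarrow> (\<Sum>r\<in>UNIV. k q p r) = 1"
    and d_pos: "d q p r > 0"
begin

text \<open>
  On a large box the discounted operator is a self-map, since \<open>1 - s d\<close> stays away from 1.
\<close>

lemma discounted_value_exists:
  assumes s: "s > 0" "\<And>q p r. s * d q p r \<le> 1"
  obtains v where "\<And>q. v q \<ge> 0"
    and "\<And>q. v q = Min ((\<lambda>p. c q p + (\<Sum>r\<in>UNIV. k q p r * ((1 - s * d q p r) * v r))) ` A q)"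
proof -
  let ?S = "range (\<lambda>(q, p, r). d q p r)"
  define \<delta> where "\<delta> = Min ?S"
  have \<delta>: "\<delta> > 0" "\<And>q p r. \<delta> \<le> d q p r"
    unfolding \<delta>_def using d_pos
    by (subst Min_gr_iff) (auto intro!: Min_le image_eqI[of _ _ "(_, _, _)"])
  define c\<^sub>0 where "c\<^sub>0 = Max (insert 0 (range (\<lambda>(q, p). c q p)))"
  have c\<^sub>0: "c q p \<le> c\<^sub>0" "0 \<le> c\<^sub>0" for q p
    unfolding c\<^sub>0_def by (rule Max_ge; auto intro!: disjI2 image_eqI[of _ _ "(_, _)"])+
  define C where "C = c\<^sub>0 / (s * \<delta>)"
  have C: "0 \<le> C" "c\<^sub>0 = s * \<delta> * C" using s \<delta> c\<^sub>0(2) by (auto simp: C_def)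
  define g where "g q p v = c q p + (\<Sum>r\<in>UNIV. k q p r * ((1 - s * d q p r) * v $ r))"
    for q p and v :: "real^'q"
  define F where "F v = (\<chi> q. Min ((\<lambda>p. g q p v) ` A q))" for v
  let ?B = "cbox 0 (\<chi> i. C) :: (real^'q) set"
  have bounds: "0 \<le> g q p v \<and> g q p v \<le> C" if v: "v \<in> ?B" and p: "p \<in> A q" for v q p
  proof
    have v: "0 \<le> v $ r" "v $ r \<le> C" for r using v by (auto simp: mem_box_cart)
    show "0 \<le> g q p v" unfolding g_def using p s v
      by (intro add_nonneg_nonneg sum_nonneg mult_nonneg_nonneg) (auto simp: c_nonneg k_nonneg)
    have "(\<Sum>r\<in>UNIV. k q p r * ((1 - s * d q p r) * v $ r)) \<le> (1 - s * \<delta>) * C"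
    proof (rule weighted_mean_le)
      fix r
      show "(1 - s * d q p r) * v $ r \<le> (1 - s * \<delta>) * C"
        using s(1) s(2)[of q p r] \<delta>(2)[of q p r] v[of r] C(1)
          order_trans[OF mult_left_mono[OF \<delta>(2)[of q p r], of s] s(2)]
        by (intro mult_mono) auto
    qed (use p in \<open>auto simp: k_nonneg k_sum\<close>)
    then show "g q p v \<le> C" using c\<^sub>0(1)[of q p] C unfolding g_def by (simp add: algebra_simps)
  qed
  have cont: "continuous_on ?B F"
    unfolding F_def g_def
    by (intro continuous_on_vec_lambda continuous_on_Min_image A_nonempty continuous_intros) auto
  have "F \<in> ?B \<rightarrow> ?B"
  proof
    fix v assume v: "v \<in> ?B"
    have "0 \<le> F v $ q \<and> F v $ q \<le> C" for q
    proof -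
      have "F v $ q \<in> (\<lambda>p. g q p v) ` A q"
        unfolding F_def using A_nonempty by (simp add: Min_in)
      then show ?thesis using bounds[OF v] by auto
    qed
    then show "F v \<in> ?B" by (simp add: mem_box_cart)
  qed
  moreover have "0 \<in> ?B" using C(1) by (simp add: mem_box_cart)
  then have "?B \<noteq> {}" by blast
  ultimately obtain v where v: "v \<in> ?B" "F v = v"
    using brouwer[of ?B F] cont by auto
  show ?thesis
  proof
    show "0 \<le> v $ q" for q using v(1) by (auto simp: mem_box_cart)
    show "v $ q = Min ((\<lambda>p. c q p + (\<Sum>r\<in>UNIV. k q p r * ((1 - s * d q p r) * v $ r))) ` A q)" for q
      using v(2) unfolding F_def g_def by (metis (no_types, lifting) vec_lambda_beta)
  qed
qed

text \<open>
  For each action the slack of the discounted optimality inequality is \<open>G / s + H + o(1)\<close>. It is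
  nonnegative for arbitrarily small \<open>s\<close>, hence \<open>G \<ge> 0\<close>, and \<open>H \<ge> 0\<close> if \<open>G = 0\<close>. For the actions
  of the optimal policy it vanishes, so \<open>G = H = 0\<close>. The growth rate inherits its sign from the
  discounted values.
\<close>

lemma lexicographically_optimal_pair:
  obtains \<rho> u :: "'q \<Rightarrow> real" and \<sigma> :: "'q \<Rightarrow> 'p"
  where "\<And>q. \<rho> q \<ge> 0" and "\<And>q. \<sigma> q \<in> A q"
    and "\<And>q. \<rho> q = (\<Sum>r\<in>UNIV. k q (\<sigma> q) r * \<rho> r)"
    and "\<And>q. u q = c q (\<sigma> q) + (\<Sum>r\<in>UNIV. k q (\<sigma> q) r * (u r - d q (\<sigma> q) r * \<rho> r))"
    and "\<And>q p. p \<in> A q \<Longrightarrow> \<rho> q \<le> (\<Sum>r\<in>UNIV. k q p r * \<rho> r)"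
    and "\<And>q p. p \<in> A q \<Longrightarrow> \<rho> q = (\<Sum>r\<in>UNIV. k q p r * \<rho> r) \<Longrightarrow>
          u q \<le> c q p + (\<Sum>r\<in>UNIV. k q p r * (u r - d q p r * \<rho> r))"
proof -
  define D where "D = Max (range (\<lambda>(q, p, r). d q p r))"
  have D: "d q p r \<le> D" for q p r
    unfolding D_def by (rule Max_ge) (auto intro!: image_eqI[of _ _ "(_, _, _)"])
  have "D > 0" using d_pos D by (meson less_le_trans)
  define s where "s n = 1 / (D * real (Suc n))" for n
  have s_pos: "s n > 0" for n using \<open>D > 0\<close> by (simp add: s_def)
  have s_small: "s n * d q p r \<le> 1" for n q p r
  proof -
    have "d q p r \<le> D * real (Suc n)"
      using D[of q p r] \<open>D > 0\<close> by (simp add: distrib_left add_increasing2)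
    then show ?thesis using \<open>D > 0\<close> by (simp add: s_def divide_simps)
  qed
  have "(\<lambda>n. inverse D * inverse (real (Suc n))) \<longlonglongrightarrow> inverse D * 0"
    by (intro tendsto_intros LIMSEQ_inverse_real_of_nat)
  moreover have "s = (\<lambda>n. inverse D * inverse (real (Suc n)))"
    by (auto simp: s_def divide_inverse)
  ultimately have s_lim: "s \<longlonglongrightarrow> 0" by simp
  define g where "g n v q p = c q p + (\<Sum>r\<in>UNIV. k q p r * ((1 - s n * d q p r) * v r))"
    for n v q p
  have "\<exists>v. (\<forall>q. v q \<ge> 0) \<and> (\<forall>q. v q = Min ((\<lambda>p. g n v q p) ` A q))" for n
    unfolding g_def by (rule discounted_value_exists[OF s_pos[of n] s_small[of n]]) blast
  then obtain v where v_nonneg: "\<And>n q. v n q \<ge> 0"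
    and v_Min: "\<And>n q. v n q = Min ((\<lambda>p. g n (v n) q p) ` A q)" by metis
  have v_le: "v n q \<le> g n (v n) q p" if "p \<in> A q" for n q p
    using v_Min[of n q] that by simp
  have optimal: "\<exists>p. p \<in> A q \<and> v n q = g n (v n) q p" for n q
    using v_Min[of n q] A_nonempty by (subst (asm) eq_Min_image_iff) auto
  define pol where "pol n q = (SOME p. p \<in> A q \<and> v n q = g n (v n) q p)" for n q
  have pol: "pol n q \<in> A q" "v n q = g n (v n) q (pol n q)" for n q
    using someI_ex[OF optimal[of q n]] unfolding pol_def by blast+
  \<comment> \<open>There are finitely many policies, so one of them is optimal for a sequence of discounts.\<close>
  obtain m where "infinite {n. pol n = pol m}"
    using pigeonhole_infinite[of "UNIV :: nat set" pol] by (auto simp: finite_subset[OF _ finite])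
  define \<sigma> where "\<sigma> = pol m"
  define i where "i = enumerate {n. pol n = \<sigma>}"
  have i: "strict_mono i" "\<And>n. pol (i n) = \<sigma>"
    using \<open>infinite _\<close> enumerate_in_set[of "{n. pol n = \<sigma>}"]
    by (auto simp: i_def \<sigma>_def intro!: strict_mono_enumerate)
  have \<sigma>: "\<sigma> q \<in> A q" for q using pol(1) by (simp add: \<sigma>_def)
  interpret chain: semi_markov_chain "\<lambda>q r. k q (\<sigma> q) r" "\<lambda>q r. d q (\<sigma> q) r"
    by unfold_locales (auto simp: k_nonneg k_sum d_pos \<sigma>)
  obtain \<rho> u where \<rho>: "\<And>q. \<rho> q = (\<Sum>r\<in>UNIV. k q (\<sigma> q) r * \<rho> r)"
    and u: "\<And>q. u q = c q (\<sigma> q) + (\<Sum>r\<in>UNIV. k q (\<sigma> q) r * (u r - d q (\<sigma> q) r * \<rho> r))"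
    by (rule chain.policy_evaluation[of "\<lambda>q. c q (\<sigma> q)"]) (rule that)
  obtain B where B: "\<And>s v q. s > 0 \<Longrightarrow> (\<And>q r. s * d q (\<sigma> q) r \<le> 1) \<Longrightarrow>
      (\<And>q. v q = c q (\<sigma> q) + (\<Sum>r\<in>UNIV. k q (\<sigma> q) r * ((1 - s * d q (\<sigma> q) r) * v r))) \<Longrightarrow>
      \<bar>v q - (\<rho> q / s + u q)\<bar> \<le> B"
    by (rule chain.discounted_value_expansion[OF \<rho> u]) (erule that)
  define y where "y n = (\<chi> q. v (i n) q - \<rho> q / s (i n))" for n
  have y_bound: "\<bar>y n $ q\<bar> \<le> B + \<bar>u q\<bar>" for n q
  proof -
    have "\<bar>v (i n) q - (\<rho> q / s (i n) + u q)\<bar> \<le> B"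
      by (intro B s_pos s_small) (rule pol(2)[of "i n", unfolded g_def i(2)])
    then show ?thesis by (simp add: y_def)
  qed
  have "norm (y n) \<le> (\<Sum>q\<in>UNIV. B + \<bar>u q\<bar>)" for n
    by (rule order_trans[OF norm_le_l1_cart]) (intro sum_mono y_bound)
  then have "bounded (range y)" by (auto simp: bounded_iff)
  then obtain w j where j: "strict_mono j" "(y \<circ> j) \<longlonglongrightarrow> w"
    using bounded_imp_convergent_subsequence by blast
  define S where "S n = s (i (j n))" for n
  have "S \<longlonglongrightarrow> 0"
    using LIMSEQ_subseq_LIMSEQ[OF s_lim strict_mono_o[OF i(1) j(1)]] by (simp add: S_def[abs_def] o_def)
  have S_pos: "S n > 0" for n by (simp add: S_def s_pos)
  define Y where "Y n q = y (j n) $ q" for n q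
  have Y: "(\<lambda>n. Y n q) \<longlonglongrightarrow> w $ q" for q
    unfolding Y_def using tendsto_vec_nth[OF j(2), of q] by (simp add: o_def)
  have v_Y: "v (i (j n)) q = \<rho> q / S n + Y n q" for n q by (simp add: Y_def y_def S_def)
  \<comment> \<open>The slack of action \<open>p\<close> at \<open>q\<close> is \<open>G / S n + H n\<close>, and \<open>H n\<close> tends to \<open>H\<^sub>0\<close>.\<close>
  define G where "G q p = (\<Sum>r\<in>UNIV. k q p r * \<rho> r) - \<rho> q" for q p
  define H where "H n q p = c q p + (\<Sum>r\<in>UNIV. k q p r * (Y n r - d q p r * \<rho> r))
    - Y n q - S n * (\<Sum>r\<in>UNIV. k q p r * (d q p r * Y n r))" for n q p
  define H\<^sub>0 where "H\<^sub>0 q p = c q p + (\<Sum>r\<in>UNIV. k q p r * (w $ r - d q p r * \<rho> r)) - w $ q" for q p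
  have slack: "g (i (j n)) (v (i (j n))) q p - v (i (j n)) q = G q p / S n + H n q p" for n q p
  proof -
    have "(\<Sum>r\<in>UNIV. k q p r * ((1 - S n * d q p r) * (\<rho> r / S n + Y n r))) =
      (\<Sum>r\<in>UNIV. k q p r * \<rho> r) / S n + (\<Sum>r\<in>UNIV. k q p r * (Y n r - d q p r * \<rho> r))
       - S n * (\<Sum>r\<in>UNIV. k q p r * (d q p r * Y n r))"
      unfolding sum_divide_distrib sum_distrib_left sum_subtractf[symmetric] sum.distrib[symmetric]
      using S_pos[of n] by (intro sum.cong refl) (simp add: field_simps)
    then show ?thesis
      unfolding g_def v_Y unfolding S_def[symmetric] G_def H_def by (simp add: diff_divide_distrib)
  qed
  have H_lim: "(\<lambda>n. H n q p) \<longlonglongrightarrow> H\<^sub>0 q p" for q p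
  proof -
    have "(\<lambda>n. H n q p) \<longlonglongrightarrow> c q p + (\<Sum>r\<in>UNIV. k q p r * (w $ r - d q p r * \<rho> r)) - w $ q
        - 0 * (\<Sum>r\<in>UNIV. k q p r * (d q p r * w $ r))"
      unfolding H_def by (intro tendsto_intros Y \<open>S \<longlonglongrightarrow> 0\<close>)
    then show ?thesis by (simp add: H\<^sub>0_def)
  qed
  have slack_nonneg: "G q p / S n + H n q p \<ge> 0" if "p \<in> A q" for n q p
    using v_le[OF that, of "i (j n)"] slack[of n q p] by simp
  show ?thesis
  proof (rule that[of \<rho> \<sigma> "($) w"])
    show "\<rho> q \<ge> 0" for q
    proof -
      have "(\<lambda>n. S n * v (i (j n)) q) = (\<lambda>n. \<rho> q + S n * Y n q)"
        using S_pos by (auto simp: v_Y field_simps less_imp_neq[symmetric])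
      moreover have "(\<lambda>n. \<rho> q + S n * Y n q) \<longlonglongrightarrow> \<rho> q + 0 * w $ q"
        by (intro tendsto_intros Y \<open>S \<longlonglongrightarrow> 0\<close>)
      ultimately have "(\<lambda>n. S n * v (i (j n)) q) \<longlonglongrightarrow> \<rho> q" by simp
      then show ?thesis
        by (rule LIMSEQ_le_const)
          (auto intro!: mult_nonneg_nonneg v_nonneg less_imp_le[OF S_pos])
    qed
    show "\<sigma> q \<in> A q" for q by (rule \<sigma>)
    show "\<rho> q = (\<Sum>r\<in>UNIV. k q (\<sigma> q) r * \<rho> r)" for q by (rule \<rho>)
    show "w $ q = c q (\<sigma> q) + (\<Sum>r\<in>UNIV. k q (\<sigma> q) r * (w $ r - d q (\<sigma> q) r * \<rho> r))" for q
    proof -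
      have "G q (\<sigma> q) = 0" using \<rho>[of q] by (simp add: G_def)
      moreover have "v (i (j n)) q = g (i (j n)) (v (i (j n))) q (\<sigma> q)" for n
        using pol(2)[of "i (j n)" q] unfolding i(2) .
      ultimately have "H n q (\<sigma> q) = 0" for n using slack[of n q "\<sigma> q"] by simp
      then have "H\<^sub>0 q (\<sigma> q) = 0"
        using H_lim[of q "\<sigma> q"] by (simp add: LIMSEQ_const_iff)
      then show ?thesis by (simp add: H\<^sub>0_def)
    qed
    fix q p assume p: "p \<in> A q"
    show "\<rho> q \<le> (\<Sum>r\<in>UNIV. k q p r * \<rho> r)"
    proof -
      have "(\<lambda>n. G q p + S n * H n q p) \<longlonglongrightarrow> G q p + 0 * H\<^sub>0 q p"
        by (intro tendsto_intros H_lim \<open>S \<longlonglongrightarrow> 0\<close>)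
      moreover have "G q p + S n * H n q p \<ge> 0" for n
        using mult_nonneg_nonneg[OF less_imp_le[OF S_pos] slack_nonneg[OF p], of n n] S_pos[of n]
        by (simp add: distrib_left)
      ultimately have "0 \<le> G q p + 0 * H\<^sub>0 q p" by (intro LIMSEQ_le_const) auto
      then show ?thesis by (simp add: G_def)
    qed
    assume "\<rho> q = (\<Sum>r\<in>UNIV. k q p r * \<rho> r)"
    then have "G q p = 0" by (simp add: G_def)
    then have "H\<^sub>0 q p \<ge> 0"
      using slack_nonneg[OF p] by (intro LIMSEQ_le_const[OF H_lim]) auto
    then show "w $ q \<le> c q p + (\<Sum>r\<in>UNIV. k q p r * (w $ r - d q p r * \<rho> r))"
      by (simp add: H\<^sub>0_def)
  qed
qed

text \<open>
  Along the line \<open>\<rho> t + u\<close> each action gives an affine function of \<open>t\<close>. By lexicographic optimality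
  these functions dominate the line for large \<open>t\<close>, with equality for the optimal policy. Starting
  the clock at such a large time makes the identity hold from time 0 on.
\<close>

lemma invariant_half_line:
  obtains \<rho> u :: "'q \<Rightarrow> real"
  where "\<And>q. \<rho> q \<ge> 0"
    and "\<And>t q. t \<ge> 0 \<Longrightarrow> \<rho> q * t + u q =
      Min ((\<lambda>p. c q p + (\<Sum>r\<in>UNIV. k q p r * (\<rho> r * (t - d q p r) + u r))) ` A q)"
proof -
  obtain \<rho> u :: "'q \<Rightarrow> real" and \<sigma> where \<rho>: "\<And>q. \<rho> q \<ge> 0" and \<sigma>: "\<And>q. \<sigma> q \<in> A q"
    and eq1: "\<And>q. \<rho> q = (\<Sum>r\<in>UNIV. k q (\<sigma> q) r * \<rho> r)"
    and eq2: "\<And>q. u q = c q (\<sigma> q) + (\<Sum>r\<in>UNIV. k q (\<sigma> q) r * (u r - d q (\<sigma> q) r * \<rho> r))"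
    and le1: "\<And>q p. p \<in> A q \<Longrightarrow> \<rho> q \<le> (\<Sum>r\<in>UNIV. k q p r * \<rho> r)"
    and le2: "\<And>q p. p \<in> A q \<Longrightarrow> \<rho> q = (\<Sum>r\<in>UNIV. k q p r * \<rho> r) \<Longrightarrow>
          u q \<le> c q p + (\<Sum>r\<in>UNIV. k q p r * (u r - d q p r * \<rho> r))"
    by (rule lexicographically_optimal_pair) (rule that)
  define a where "a q p = (\<Sum>r\<in>UNIV. k q p r * \<rho> r)" for q p
  define b where "b q p = c q p + (\<Sum>r\<in>UNIV. k q p r * (u r - d q p r * \<rho> r))" for q p
  have affine: "c q p + (\<Sum>r\<in>UNIV. k q p r * (\<rho> r * (t - d q p r) + u r)) = a q p * t + b q p"
    for q p t
    by (simp add: a_def b_def algebra_simps sum.distrib sum_subtractf sum_distrib_left)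
  have "\<forall>\<^sub>F t in at_top. p \<in> A q \<longrightarrow> \<rho> q * t + u q \<le> a q p * t + b q p" for q p
  proof (cases "p \<in> A q \<and> \<rho> q \<noteq> a q p")
    case True
    then have pos: "a q p - \<rho> q > 0" using le1[of p q] by (simp add: a_def)
    show ?thesis
      using eventually_ge_at_top[of "(u q - b q p) / (a q p - \<rho> q)"]
    proof eventually_elim
      case (elim t)
      then show ?case using pos by (simp add: field_simps)
    qed
  qed (use le2[of p q] in \<open>auto simp: a_def b_def\<close>)
  then have "\<forall>\<^sub>F t in at_top. \<forall>q p. p \<in> A q \<longrightarrow> \<rho> q * t + u q \<le> a q p * t + b q p"
    by (simp add: eventually_all_finite)
  then obtain t\<^sub>0 where t\<^sub>0: "\<And>t q p. t \<ge> t\<^sub>0 \<Longrightarrow> p \<in> A q \<Longrightarrow> \<rho> q * t + u q \<le> a q p * t + b q p"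
    unfolding eventually_at_top_linorder by blast
  show ?thesis
  proof (rule that[of \<rho> "\<lambda>q. u q + \<rho> q * t\<^sub>0"])
    fix t :: real and q assume "t \<ge> 0"
    have "c q p + (\<Sum>r\<in>UNIV. k q p r * (\<rho> r * (t - d q p r) + (u r + \<rho> r * t\<^sub>0))) =
        a q p * (t + t\<^sub>0) + b q p" for p
      unfolding affine[symmetric] by (simp add: algebra_simps)
    moreover have "\<rho> q * (t + t\<^sub>0) + u q = Min ((\<lambda>p. a q p * (t + t\<^sub>0) + b q p) ` A q)"
    proof (subst eq_Min_image_iff, safe)
      have "\<rho> q * (t + t\<^sub>0) + u q = a q (\<sigma> q) * (t + t\<^sub>0) + b q (\<sigma> q)"
        by (simp only: a_def b_def eq1[of q, symmetric] eq2[of q, symmetric])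
      then show "\<exists>p\<in>A q. \<rho> q * (t + t\<^sub>0) + u q = a q p * (t + t\<^sub>0) + b q p"
        using \<sigma> by blast
    qed (use t\<^sub>0[of "t + t\<^sub>0"] \<open>t \<ge> 0\<close> A_nonempty in auto)
    ultimately show "\<rho> q * t + (u q + \<rho> q * t\<^sub>0) = Min ((\<lambda>p. c q p +
        (\<Sum>r\<in>UNIV. k q p r * (\<rho> r * (t - d q p r) + (u r + \<rho> r * t\<^sub>0)))) ` A q)"
      by (simp add: algebra_simps)
  qed (rule \<rho>)
qed

end
section \<open>The precedence order of firings\<close>

definition instant_dependency :: "('p, 'q) fluid_net \<Rightarrow> 'q rel" where
  "instant_dependency N =
     {(q, r). \<exists>p\<in>trans_in N q. r \<in> place_in N p \<and> holding N p = 0}"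

text \<open>
  Dependencies point against the arcs of the net. The arc into \<open>q\<close> is kept apart from the path,
  so that for \<open>q = r\<close> it is the arc that closes a circuit.
\<close>

lemma instant_dependency_path:
  assumes "(q, r) \<in> (instant_dependency N)\<^sup>+"
  shows "\<exists>vs. successively (\<lambda>a b. (a, b) \<in> arcs N) (Inr r # vs) \<and>
    (last (Inr r # vs), Inr q) \<in> arcs N \<and> (\<forall>p. Inl p \<in> set vs \<longrightarrow> holding N p = 0)"
  using assms
proof (induction rule: trancl_induct)
  case (base r)
  then obtain p where "(p, q) \<in> arcs_pt N" "(r, p) \<in> arcs_tp N" "holding N p = 0"
    by (auto simp: instant_dependency_def trans_in_def place_in_def)
  then show ?case by (intro exI[of _ "[Inl p]"]) (auto simp: arcs_def)
next
  case (step y r)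
  then obtain p where "(p, y) \<in> arcs_pt N" "(r, p) \<in> arcs_tp N" "holding N p = 0"
    by (auto simp: instant_dependency_def trans_in_def place_in_def)
  moreover obtain vs where "successively (\<lambda>a b. (a, b) \<in> arcs N) (Inr y # vs)"
    "(last (Inr y # vs), Inr q) \<in> arcs N" "\<forall>p. Inl p \<in> set vs \<longrightarrow> holding N p = 0"
    using step.IH by blast
  ultimately show ?case by (intro exI[of _ "Inl p # Inr y # vs"]) (auto simp: arcs_def)
qed

lemma acyclic_instant_dependency:
  assumes "non_zeno N"
  shows "acyclic (instant_dependency N)"
  unfolding acyclic_def
proof (intro allI notI)
  fix q assume cycle: "(q, q) \<in> (instant_dependency N)\<^sup>+"
  obtain vs where vs: "successively (\<lambda>a b. (a, b) \<in> arcs N) (Inr q # vs)"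
    "(last (Inr q # vs), Inr q) \<in> arcs N" "\<forall>p. Inl p \<in> set vs \<longrightarrow> holding N p = 0"
    using instant_dependency_path[OF cycle] by (elim exE conjE)
  define ws where "ws = Inr q # vs"
  have "(ws ! i, ws ! (Suc i mod length ws)) \<in> arcs N" if "i < length ws" for i
  proof (cases "Suc i < length ws")
    case True
    then show ?thesis using vs(1) by (simp add: ws_def[symmetric] successively_conv_nth)
  next
    case False
    then have i: "Suc i = length ws" using that by simp
    have "ws \<noteq> []" by (simp add: ws_def)
    then have "last ws = ws ! i" using i by (simp add: last_conv_nth flip: i)
    then have "(ws ! i, ws ! 0) \<in> arcs N" using vs(2) by (simp add: ws_def)
    then show ?thesis unfolding i by simp
  qed
  then have "directed_circuit N ws" by (auto simp: directed_circuit_def ws_def)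
  moreover have "\<forall>p. Inl p \<in> set ws \<longrightarrow> holding N p = 0" using vs(3) by (auto simp: ws_def)
  ultimately show False using assms by (auto simp: non_zeno_def)
qed

text \<open>
  The number of transitions on which \<open>q\<close> depends without delay drops strictly along each
  dependency of zero delay. A small multiple of it is therefore a potential that makes those delays
  positive and does not use up the positive holding times.
\<close>

lemma positive_reduced_delays:
  fixes N :: "('p::finite, 'q::finite) fluid_net"
  assumes net: "fluid_petri_net N" and nz: "non_zeno N"
  obtains h :: "'q \<Rightarrow> real" and \<delta> where "\<delta> > 0" "\<And>q. h q \<ge> 0"
    "\<And>q p r. p \<in> trans_in N q \<Longrightarrow> r \<in> place_in N p \<Longrightarrow> \<delta> \<le> holding N p + h q - h r"
proof -
  define level where "level q = card {r. (q, r) \<in> (instant_dependency N)\<^sup>+}" for q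
  have level_less: "level r < level q" if "(q, r) \<in> instant_dependency N" for q r
    unfolding level_def
  proof (rule psubset_card_mono)
    have "(r, r) \<notin> (instant_dependency N)\<^sup>+"
      using acyclic_instant_dependency[OF nz] by (simp add: acyclic_def)
    then show "{x. (r, x) \<in> (instant_dependency N)\<^sup>+} \<subset> {x. (q, x) \<in> (instant_dependency N)\<^sup>+}"
      using that by (auto intro: trancl_into_trancl2)
  qed simp
  define \<epsilon> where "\<epsilon> = Min (insert 1 (holding N ` {p. holding N p > 0}))"
  have "\<epsilon> > 0" unfolding \<epsilon>_def by (subst Min_gr_iff) auto
  have \<epsilon>: "\<epsilon> \<le> holding N p" if "holding N p > 0" for p
    unfolding \<epsilon>_def using that by (intro Min_le) auto
  define n where "n = CARD('q)"
  have level_le: "level q \<le> n" for q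
    unfolding level_def n_def by (intro card_mono) auto
  \<comment> \<open>Levels differ by at most \<open>n\<close>, so a positive holding time keeps at least \<open>\<epsilon> - n \<delta> = \<delta>\<close>.\<close>
  define \<delta> where "\<delta> = \<epsilon> / (real n + 1)"
  have "\<delta> > 0" using \<open>\<epsilon> > 0\<close> by (simp add: \<delta>_def)
  have "real n + 1 \<noteq> 0" by linarith
  then have "\<delta> * (real n + 1) = \<epsilon>" using \<delta>_def nonzero_eq_divide_eq by blast
  then have \<epsilon>_eq: "\<epsilon> = \<delta> * n + \<delta>" by (simp add: distrib_left)
  show ?thesis
  proof (rule that[of \<delta> "\<lambda>q. \<delta> * level q"])
    show "\<delta> > 0" "\<And>q. 0 \<le> \<delta> * real (level q)" using \<open>\<delta> > 0\<close> by auto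
    fix q p r assume pr: "p \<in> trans_in N q" "r \<in> place_in N p"
    have "0 \<le> holding N p" using net by (simp add: fluid_petri_net_def)
    show "\<delta> \<le> holding N p + \<delta> * level q - \<delta> * level r"
    proof (cases "holding N p = 0")
      case True
      then have "level r < level q" using pr by (intro level_less) (auto simp: instant_dependency_def)
      then have "\<delta> * (real (level r) + 1) \<le> \<delta> * real (level q)"
        using \<open>\<delta> > 0\<close> by (intro mult_left_mono) auto
      then show ?thesis using True by (simp add: algebra_simps)
    next
      case False
      then have "\<epsilon> \<le> holding N p" using \<epsilon> \<open>0 \<le> holding N p\<close> by simp
      moreover have "\<delta> * level r \<le> \<delta> * n" "0 \<le> \<delta> * level q"
        using \<open>\<delta> > 0\<close> level_le[of r] by auto
      ultimately show ?thesis using \<epsilon>_eq by linarith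
    qed
  qed
qed

definition firing_dependency :: "('p, 'q) fluid_net \<Rightarrow> (real \<times> 'q) rel" where
  "firing_dependency N = {((t - holding N p, r), (t, q)) | t p q r.
     t > 0 \<and> p \<in> trans_in N q \<and> r \<in> place_in N p}"

text \<open>
  With the potential \<open>h\<close> and the lower bound \<open>\<delta>\<close> on the reduced delays, each dependency lowers
  \<open>t + h q\<close> by at least \<open>\<delta>\<close>, and this quantity is positive wherever the
  dynamics applies.
\<close>

lemma wf_firing_dependency:
  fixes N :: "('p::finite, 'q::finite) fluid_net"
  assumes "fluid_petri_net N" "non_zeno N"
  shows "wf (firing_dependency N)"
proof -
  obtain h :: "'q \<Rightarrow> real" and \<delta> where \<delta>: "\<delta> > 0" and h: "\<And>q. h q \<ge> 0"
    and delay: "\<And>q p r. p \<in> trans_in N q \<Longrightarrow> r \<in> place_in N p \<Longrightarrow> \<delta> \<le> holding N p + h q - h r"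
    using positive_reduced_delays[OF assms] by metis
  have "nat \<lceil>(t - holding N p + h r) / \<delta>\<rceil> < nat \<lceil>(t + h q) / \<delta>\<rceil>"
    if "t > 0" "p \<in> trans_in N q" "r \<in> place_in N p" for t p q r
  proof -
    have "(t - holding N p + h r) / \<delta> \<le> (t + h q - \<delta>) / \<delta>"
      using delay[OF that(2,3)] \<delta> by (intro divide_right_mono) auto
    also have "\<dots> = (t + h q) / \<delta> - 1" using \<delta> by (simp add: diff_divide_distrib)
    finally have "(t - holding N p + h r) / \<delta> \<le> (t + h q) / \<delta> - 1" .
    moreover have "(t + h q) / \<delta> > 0" using that(1) h[of q] \<delta> by (simp add: add_pos_nonneg)
    ultimately show ?thesis by linarith
  qed
  then have "firing_dependency N \<subseteq> Wellfounded.measure (\<lambda>(t, q). nat \<lceil>(t + h q) / \<delta>\<rceil>)"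
    by (auto simp: firing_dependency_def)
  then show ?thesis by (rule wf_subset[OF wf_measure])
qed

section \<open>Existence and comparison of trajectories\<close>

definition firing_bound ::
    "('p, 'q::finite) fluid_net \<Rightarrow> (real \<Rightarrow> real ^ 'q) \<Rightarrow> real \<Rightarrow> 'q \<Rightarrow> 'p \<Rightarrow> real" where
  "firing_bound N z t q p = routing N q p / weight_pt N q p *
     (marking N p + (\<Sum>r\<in>place_in N p. weight_tp N p r * z (t - holding N p) $ r))"

lemma trajectory_iff:
  "trajectory N z \<longleftrightarrow> (\<forall>t>0. \<forall>q. z t $ q = Min (firing_bound N z t q ` trans_in N q))"
  by (simp add: trajectory_def firing_bound_def[abs_def])

lemma firing_bound_le:
  fixes N :: "('p::finite, 'q::finite) fluid_net"
  assumes "trajectory N z" "t > 0" "p \<in> trans_in N q"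
  shows "z t $ q \<le> firing_bound N z t q p"
  using assms by (simp add: trajectory_iff)

lemma firing_bound_attained:
  fixes N :: "('p::finite, 'q::finite) fluid_net"
  assumes "fluid_petri_net N" "trajectory N z" "t > 0"
  obtains p where "p \<in> trans_in N q" "z t $ q = firing_bound N z t q p"
proof -
  have "z t $ q = Min (firing_bound N z t q ` trans_in N q)" "trans_in N q \<noteq> {}"
    using assms by (auto simp: trajectory_iff fluid_petri_net_def)
  then show ?thesis using that by (subst (asm) eq_Min_image_iff) auto
qed

lemma routing_ratio_nonneg:
  fixes N :: "('p::finite, 'q::finite) fluid_net"
  assumes "fluid_petri_net N" "p \<in> trans_in N q"
  shows "routing N q p / weight_pt N q p \<ge> 0"
proof -
  have "q \<in> place_out N p" "weight_pt N q p > 0"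
    using assms by (auto simp: fluid_petri_net_def trans_in_def place_out_def)
  moreover have "preselection_place N p \<or> single_output_place N p"
    using assms by (auto simp: fluid_petri_net_def)
  ultimately show ?thesis by (auto simp: preselection_place_def single_output_place_def)
qed

lemma trajectory_from_exists:
  fixes N :: "('p::finite, 'q::finite) fluid_net"
  assumes "fluid_petri_net N" "non_zeno N"
  obtains z where "trajectory_from N z0 z"
proof -
  define F where "F f = (\<lambda>(t, q). if t > 0
      then Min ((\<lambda>p. routing N q p / weight_pt N q p * (marking N p +
        (\<Sum>r\<in>place_in N p. weight_tp N p r * f (t - holding N p, r)))) ` trans_in N q)
      else z0 t $ q)" for f
  define Z where "Z = wfrec (firing_dependency N) F"
  have "adm_wf (firing_dependency N) F"
    unfolding adm_wf_def
  proof (intro allI impI)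
    fix f g :: "real \<times> 'q \<Rightarrow> real" and x
    assume fg: "\<forall>y. (y, x) \<in> firing_dependency N \<longrightarrow> f y = g y"
    obtain t q where x: "x = (t, q)" by fastforce
    have "f (t - holding N p, r) = g (t - holding N p, r)"
      if "t > 0" "p \<in> trans_in N q" "r \<in> place_in N p" for p r
      using fg that by (auto simp: x firing_dependency_def)
    then show "F f x = F g x" by (auto simp: F_def x intro!: arg_cong[where f = Min] image_cong)
  qed
  then have "Z = F Z"
    unfolding Z_def by (rule wfrec_fixpoint[OF wf_firing_dependency[OF assms]])
  then have Z: "Z (t, q) = F Z (t, q)" for t q by simp
  have "trajectory_from N z0 (\<lambda>t. \<chi> q. Z (t, q))"
    unfolding trajectory_from_def trajectory_def
  proof (intro conjI allI impI ballI)
    show "(\<chi> q. Z (t, q)) $ q = Min ((\<lambda>p. routing N q p / weight_pt N q p * (marking N p +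
        (\<Sum>q'\<in>place_in N p. weight_tp N p q' * (\<chi> q. Z (t - holding N p, q)) $ q'))) ` trans_in N q)"
      if "0 < t" for t q
      using Z[of t q] that by (simp add: F_def)
    show "(\<chi> q. Z (t, q)) = z0 t" if "t \<in> {- max_holding N..0}" for t
      using Z[of t] that by (simp add: F_def vec_eq_iff)
  qed
  then show ?thesis by (rule that)
qed

text \<open>
  Adding \<open>K e\<close> to a trajectory adds exactly \<open>K e\<close> to each term of the minimum, because \<open>e\<close> is
  invariant, and the minimum is monotone. The estimate therefore propagates along the well-founded
  order of firings.
\<close>

lemma trajectory_comparison:
  fixes N :: "('p::finite, 'q::finite) fluid_net"
  assumes net: "fluid_petri_net N" and nz: "non_zeno N" and inv: "stoichiometric_invariant N e"
    and z: "trajectory N z" and z': "trajectory N z'"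
    and init: "\<And>t q. t \<in> {- max_holding N..0} \<Longrightarrow> z t $ q \<le> z' t $ q + K * e $ q"
    and "t \<ge> - max_holding N"
  shows "z t $ q \<le> z' t $ q + K * e $ q"
proof -
  have "t \<ge> - max_holding N \<longrightarrow> z t $ q \<le> z' t $ q + K * e $ q"
    using wf_firing_dependency[OF net nz]
  proof (induction "(t, q)" arbitrary: t q rule: wf_induct_rule)
    case less
    show ?case
    proof (intro impI, cases "t > 0")
      case True
      obtain p where p: "p \<in> trans_in N q" "z' t $ q = firing_bound N z' t q p"
        using firing_bound_attained[OF net z' True] .
      define a where "a = routing N q p / weight_pt N q p"
      have "holding N p \<le> max_holding N" unfolding max_holding_def by (rule Max_ge) auto
      then have "z (t - holding N p) $ r \<le> z' (t - holding N p) $ r + K * e $ r"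
        if "r \<in> place_in N p" for r
        using less[of "t - holding N p" r] True p(1) that by (auto simp: firing_dependency_def)
      then have "weight_tp N p r * z (t - holding N p) $ r \<le>
          weight_tp N p r * (z' (t - holding N p) $ r + K * e $ r)" if "r \<in> place_in N p" for r
        using net that
        by (intro mult_left_mono) (auto simp: fluid_petri_net_def place_in_def less_imp_le)
      then have "(\<Sum>r\<in>place_in N p. weight_tp N p r * z (t - holding N p) $ r) \<le>
        (\<Sum>r\<in>place_in N p. weight_tp N p r * (z' (t - holding N p) $ r + K * e $ r))"
        by (rule sum_mono)
      then have "a * (marking N p + (\<Sum>r\<in>place_in N p. weight_tp N p r * z (t - holding N p) $ r)) \<le>
        a * (marking N p + (\<Sum>r\<in>place_in N p. weight_tp N p r * (z' (t - holding N p) $ r + K * e $ r)))"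
        using routing_ratio_nonneg[OF net p(1)] by (intro mult_left_mono) (auto simp: a_def)
      also have "\<dots> = firing_bound N z' t q p + K * (a * (\<Sum>r\<in>place_in N p. weight_tp N p r * e $ r))"
        unfolding firing_bound_def a_def[symmetric]
        by (simp add: algebra_simps sum.distrib sum_distrib_left)
      also have "a * (\<Sum>r\<in>place_in N p. weight_tp N p r * e $ r) = e $ q"
        using inv p(1) by (simp add: stoichiometric_invariant_def a_def)
      finally have "firing_bound N z t q p \<le> firing_bound N z' t q p + K * e $ q"
        by (simp add: firing_bound_def a_def)
      then show "z t $ q \<le> z' t $ q + K * e $ q"
        using firing_bound_le[OF z True p(1)] p(2) by simp
    qed (use init in auto)
  qed
  then show ?thesis using assms by blast
qed

section \<open>Affine stationary regimes\<close>

text \<open>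
  This is the passage to the decision process: values are divided by \<open>e\<close>, and the process at
  transition \<open>q\<close> and time \<open>t + h q\<close> stands for the net at time \<open>t\<close>. As \<open>h \<ge> 0\<close>, positive times of
  the net lie on the half-line of the process.
\<close>

lemma affine_trajectory_exists:
  fixes N :: "('p::finite, 'q::finite) fluid_net" and e :: "real ^ 'q"
  assumes net: "fluid_petri_net N" and nz: "non_zeno N" and inv: "stoichiometric_invariant N e"
    and pos: "\<And>q. e $ q > 0"
  obtains \<rho> u where "\<And>q. \<rho> $ q \<ge> 0" "trajectory N (\<lambda>t. t *\<^sub>R \<rho> + u)"
proof -
  obtain h :: "'q \<Rightarrow> real" and \<delta> where \<delta>: "\<delta> > 0" and h: "\<And>q. h q \<ge> 0"
    and delay: "\<And>q p r. p \<in> trans_in N q \<Longrightarrow> r \<in> place_in N p \<Longrightarrow> \<delta> \<le> holding N p + h q - h r"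
    using positive_reduced_delays[OF net nz] by metis
  define a where "a q p = routing N q p / weight_pt N q p" for q p
  define c where "c q p = a q p * marking N p / e $ q" for q p
  define k where "k q p r = (if r \<in> place_in N p then a q p * weight_tp N p r * e $ r / e $ q else 0)"
    for q p r
  \<comment> \<open>The value 1 off the arcs is arbitrary: these delays occur with probability 0 or not at all.\<close>
  define d where "d q p r = (if p \<in> trans_in N q \<and> r \<in> place_in N p
    then holding N p + h q - h r else 1)" for q p r
  have a_nonneg: "a q p \<ge> 0" if "p \<in> trans_in N q" for q p
    using routing_ratio_nonneg[OF net that] by (simp add: a_def)
  have e_eq: "e $ q = a q p * (\<Sum>r\<in>place_in N p. weight_tp N p r * e $ r)"
    if "p \<in> trans_in N q" for q p
    using inv that by (simp add: stoichiometric_invariant_def a_def)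
  interpret semi_markov_decision "trans_in N" c k d
  proof
    fix q p r
    show "trans_in N q \<noteq> {}" using net by (simp add: fluid_petri_net_def)
    show "d q p r > 0" using delay[of p q r] \<delta> by (auto simp: d_def)
    assume p: "p \<in> trans_in N q"
    show "c q p \<ge> 0"
      using net a_nonneg[OF p] pos[of q] by (simp add: c_def fluid_petri_net_def)
    show "k q p r \<ge> 0"
      using net a_nonneg[OF p] pos[of q] pos[of r]
      by (auto simp: k_def fluid_petri_net_def place_in_def less_imp_le)
    have "(\<Sum>r\<in>UNIV. k q p r) = a q p * (\<Sum>r\<in>place_in N p. weight_tp N p r * e $ r) / e $ q"
      by (simp add: k_def sum.If_cases sum_distrib_left sum_divide_distrib mult.assoc)
    then show "(\<Sum>r\<in>UNIV. k q p r) = 1"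
      unfolding e_eq[OF p, symmetric] using pos[of q] by simp
  qed
  obtain \<rho> u :: "'q \<Rightarrow> real" where \<rho>: "\<And>q. \<rho> q \<ge> 0"
    and half_line: "\<And>t q. t \<ge> 0 \<Longrightarrow> \<rho> q * t + u q =
      Min ((\<lambda>p. c q p + (\<Sum>r\<in>UNIV. k q p r * (\<rho> r * (t - d q p r) + u r))) ` trans_in N q)"
    by (rule invariant_half_line) (rule that)
  define \<rho>' where "\<rho>' = (\<chi> q. e $ q * \<rho> q)"
  define u' where "u' = (\<chi> q. e $ q * (u q + \<rho> q * h q))"
  have bound: "firing_bound N (\<lambda>t. t *\<^sub>R \<rho>' + u') t q p =
      e $ q * (c q p + (\<Sum>r\<in>UNIV. k q p r * (\<rho> r * (t + h q - d q p r) + u r)))"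
    if p: "p \<in> trans_in N q" for t q p
  proof -
    have "(\<Sum>r\<in>UNIV. k q p r * (\<rho> r * (t + h q - d q p r) + u r)) =
      (\<Sum>r\<in>UNIV. if r \<in> place_in N p then a q p *
        (weight_tp N p r * ((t - holding N p) *\<^sub>R \<rho>' + u') $ r) / e $ q else 0)"
    proof (intro sum.cong refl)
      fix r
      show "k q p r * (\<rho> r * (t + h q - d q p r) + u r) = (if r \<in> place_in N p then a q p *
        (weight_tp N p r * ((t - holding N p) *\<^sub>R \<rho>' + u') $ r) / e $ q else 0)"
      proof (cases "r \<in> place_in N p")
        case True
        then have shift: "t + h q - d q p r = t - holding N p + h r" using p by (simp add: d_def)
        show ?thesis
          unfolding shift using True
          by (simp add: k_def \<rho>'_def u'_def algebra_simps add_divide_distrib diff_divide_distrib)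
      qed (simp add: k_def)
    qed
    also have "\<dots> = a q p *
        (\<Sum>r\<in>place_in N p. weight_tp N p r * ((t - holding N p) *\<^sub>R \<rho>' + u') $ r) / e $ q"
      by (simp only: sum.If_cases finite Collect_mem_eq sum_distrib_left sum_divide_distrib) simp
    finally show ?thesis
      using pos[of q] by (simp add: firing_bound_def a_def[symmetric] c_def distrib_left)
  qed
  have "trajectory N (\<lambda>t. t *\<^sub>R \<rho>' + u')"
    unfolding trajectory_iff
  proof (intro allI impI)
    fix t :: real and q assume "t > 0"
    then have "t + h q \<ge> 0" using h[of q] by simp
    define m where "m = \<rho> q * (t + h q) + u q"
    define f where "f p = c q p + (\<Sum>r\<in>UNIV. k q p r * (\<rho> r * (t + h q - d q p r) + u r))" for p
    have "m = Min (f ` trans_in N q)"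
      using half_line[OF \<open>t + h q \<ge> 0\<close>, of q] unfolding m_def f_def .
    then have m: "(\<forall>p\<in>trans_in N q. m \<le> f p) \<and> (\<exists>p\<in>trans_in N q. m = f p)"
      by (subst (asm) eq_Min_image_iff) (auto simp: A_nonempty)
    have bound_f: "firing_bound N (\<lambda>t. t *\<^sub>R \<rho>' + u') t q p = e $ q * f p"
      if "p \<in> trans_in N q" for p
      using bound[OF that] by (simp add: f_def)
    have "(t *\<^sub>R \<rho>' + u') $ q = e $ q * m"
      by (simp add: \<rho>'_def u'_def m_def algebra_simps)
    moreover have "e $ q * m = Min (firing_bound N (\<lambda>t. t *\<^sub>R \<rho>' + u') t q ` trans_in N q)"
    proof (subst eq_Min_image_iff)
      show "(\<forall>p\<in>trans_in N q. e $ q * m \<le> firing_bound N (\<lambda>t. t *\<^sub>R \<rho>' + u') t q p) \<and>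
          (\<exists>p\<in>trans_in N q. e $ q * m = firing_bound N (\<lambda>t. t *\<^sub>R \<rho>' + u') t q p)"
        using m bound_f pos[of q] by (metis less_imp_le mult_left_mono)
    qed (simp_all add: A_nonempty)
    ultimately show "(t *\<^sub>R \<rho>' + u') $ q =
        Min (firing_bound N (\<lambda>t. t *\<^sub>R \<rho>' + u') t q ` trans_in N q)" by simp
  qed
  then show ?thesis using \<rho> pos by (intro that) (auto simp: \<rho>'_def less_imp_le)
qed

lemma max_holding_nonneg: "fluid_petri_net N \<Longrightarrow> max_holding N \<ge> 0"
  unfolding max_holding_def fluid_petri_net_def by (subst Max_ge_iff) auto

lemma affine_stationary_regime_exists:
  fixes N :: "('p::finite, 'q::finite) fluid_net" and e :: "real ^ 'q"
  assumes net: "fluid_petri_net N" and nz: "non_zeno N" and inv: "stoichiometric_invariant N e"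
    and pos: "\<And>q. e $ q > 0"
  shows "\<exists>\<rho> u. affine_stationary_regime N \<rho> u"
proof -
  obtain \<rho> u where \<rho>: "\<And>q. \<rho> $ q \<ge> 0" and traj: "trajectory N (\<lambda>t. t *\<^sub>R \<rho> + u)"
    using affine_trajectory_exists[OF assms] by blast
  have "z t = t *\<^sub>R \<rho> + u" if z: "trajectory_from N (\<lambda>t. t *\<^sub>R \<rho> + u) z" and "t \<ge> 0" for z t
  proof -
    have t: "t \<ge> - max_holding N" using max_holding_nonneg[OF net] \<open>t \<ge> 0\<close> by linarith
    have "z t $ q \<le> (t *\<^sub>R \<rho> + u) $ q" "(t *\<^sub>R \<rho> + u) $ q \<le> z t $ q" for q
      using trajectory_comparison[OF net nz inv _ traj, of z 0 t q]
        trajectory_comparison[OF net nz inv traj, of z 0 t q] z t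
      by (auto simp: trajectory_from_def)
    then show ?thesis by (simp add: vec_eq_iff order_antisym)
  qed
  moreover have "trajectory_from N (\<lambda>t. t *\<^sub>R \<rho> + u) (\<lambda>t. t *\<^sub>R \<rho> + u)"
    using traj by (simp add: trajectory_from_def)
  ultimately show ?thesis using \<rho> unfolding affine_stationary_regime_def by blast
qed

text \<open>
  A positive vector \<open>e\<close> is an order unit, so a uniform bound on the initial interval is a bound by
  a multiple of \<open>e\<close>, to which the comparison principle applies in both directions.
\<close>

lemma trajectories_at_bounded_distance:
  fixes N :: "('p::finite, 'q::finite) fluid_net" and e :: "real ^ 'q"
  assumes net: "fluid_petri_net N" and nz: "non_zeno N" and inv: "stoichiometric_invariant N e"
    and pos: "\<And>q. e $ q > 0"
    and z: "trajectory N z" and z': "trajectory N z'"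
    and init: "\<And>t. t \<in> {- max_holding N..0} \<Longrightarrow> norm (z t - z' t) \<le> B"
  obtains C where "\<And>t q. t \<ge> - max_holding N \<Longrightarrow> \<bar>z t $ q - z' t $ q\<bar> \<le> C * e $ q"
proof
  fix t q assume t: "t \<ge> - max_holding N"
  define m where "m = Min (range (($) e))"
  have "m > 0" unfolding m_def using pos by (subst Min_gr_iff) auto
  have m_le: "m \<le> e $ q" for q unfolding m_def by (rule Min_le) auto
  have "norm (z 0 - z' 0) \<le> B" using max_holding_nonneg[OF net] by (intro init) auto
  then have "B \<ge> 0" using norm_ge_zero order_trans by blast
  have B_le: "B \<le> B / m * e $ q" for q
    using mult_left_mono[OF m_le \<open>B \<ge> 0\<close>, of q] \<open>m > 0\<close> by (simp add: field_simps)
  have "\<bar>z t $ q - z' t $ q\<bar> \<le> B / m * e $ q" if "t \<in> {- max_holding N..0}" for t q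
    using component_le_norm_cart[of "z t - z' t" q] init[OF that] B_le[of q] by simp
  then have "z t $ q \<le> z' t $ q + B / m * e $ q" "z' t $ q \<le> z t $ q + B / m * e $ q"
    if "t \<in> {- max_holding N..0}" for t q
    using that by (simp_all add: abs_le_iff add.commute diff_le_eq)
  then have "z t $ q \<le> z' t $ q + B / m * e $ q" "z' t $ q \<le> z t $ q + B / m * e $ q"
    using trajectory_comparison[OF net nz inv z z' _ t] trajectory_comparison[OF net nz inv z' z _ t]
    by blast+
  then show "\<bar>z t $ q - z' t $ q\<bar> \<le> B / Min (range (($) e)) * e $ q"
    by (simp add: m_def abs_le_iff)
qed

theorem theorem6p12:
  fixes N :: "('p::finite, 'q::finite) fluid_net" and e :: "real ^ 'q"
  assumes "fluid_petri_net N"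
    and "non_zeno N"
    and "stoichiometric_invariant N e"
    and "\<forall>q. e $ q > 0"
  shows "(\<exists>\<rho> u. affine_stationary_regime N \<rho> u) \<and>
    (\<forall>\<rho> u. affine_stationary_regime N \<rho> u \<longrightarrow>
      (\<forall>z0. continuous_on {- max_holding N..0} z0 \<longrightarrow>
        (\<exists>z. trajectory_from N z0 z) \<and>
        (\<forall>z. trajectory_from N z0 z \<longrightarrow>
          (\<forall>q. (\<lambda>t. z t $ q - \<rho> $ q * t) \<in> O[at_top](\<lambda>_. 1)))))"
proof (intro conjI allI impI)
  show "\<exists>\<rho> u. affine_stationary_regime N \<rho> u"
    using affine_stationary_regime_exists assms by blast
next
  fix z0
  show "\<exists>z. trajectory_from N z0 z"
    using trajectory_from_exists assms(1,2) by blast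
next
  fix \<rho> u z0 z q
  assume regime: "affine_stationary_regime N \<rho> u"
    and z0: "continuous_on {- max_holding N..0} z0" and z: "trajectory_from N z0 z"
  obtain y where y: "trajectory_from N (\<lambda>t. t *\<^sub>R \<rho> + u) y" "\<And>t. t \<ge> 0 \<Longrightarrow> y t = t *\<^sub>R \<rho> + u"
    using regime unfolding affine_stationary_regime_def by blast
  have "continuous_on {- max_holding N..0} (\<lambda>t. z0 t - (t *\<^sub>R \<rho> + u))"
    by (intro continuous_intros z0)
  then have "bounded ((\<lambda>t. z0 t - (t *\<^sub>R \<rho> + u)) ` {- max_holding N..0})"
    using compact_continuous_image compact_imp_bounded by blast
  then obtain B where B: "\<And>t. t \<in> {- max_holding N..0} \<Longrightarrow> norm (z0 t - (t *\<^sub>R \<rho> + u)) \<le> B"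
    unfolding bounded_iff by blast
  have "norm (z t - y t) \<le> B" if "t \<in> {- max_holding N..0}" for t
    using B[OF that] z y(1) that by (simp add: trajectory_from_def)
  then obtain C where C: "\<And>t q. t \<ge> - max_holding N \<Longrightarrow> \<bar>z t $ q - y t $ q\<bar> \<le> C * e $ q"
    using trajectories_at_bounded_distance[OF assms(1-3), of z y B] assms(4) z y(1)
    unfolding trajectory_from_def by blast
  have "\<bar>z t $ q - \<rho> $ q * t\<bar> \<le> C * e $ q + \<bar>u $ q\<bar>" if "t \<ge> 0" for t
    using C[of t q] y(2)[OF that] max_holding_nonneg[OF assms(1)] that by (simp add: mult.commute)
  then show "(\<lambda>t. z t $ q - \<rho> $ q * t) \<in> O[at_top](\<lambda>_. 1)"
    by (intro bigoI[of _ "C * e $ q + \<bar>u $ q\<bar>"] eventually_mono[OF eventually_ge_at_top[of 0]]) auto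
qed

end
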